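(* Let $(U(t,s))_{t\ge s}$ be an evolution family of bounded linear operators on a real separable Hilbert space $\mathbb{H}$ and let $(\mu_{t,s})_{t\ge s}$ be Borel probability measures on $\mathbb{H}$ such that $\mu_{t,s}=\mu_{t,r}*(\mu_{r,s}\circ U(t,r)^{-1})$ for all $t\ge r\ge s$. Suppose that for every $s\in\mathbb{R}$, $\mu_{t,s}\Rightarrow\delta_0$ as $t\downarrow s$, and that for every $t\in\mathbb{R}$, $\mu_{t,s}\Rightarrow\delta_0$ as $s\uparrow t$. Then: (i) For every $t\in\mathbb{R}$, the map $s\mapsto\mu_{t,s}$, $s\le t$, is weakly continuous. (ii) For all $t\ge s$, $\mu_{t+\varepsilon,s}\Rightarrow\mu_{t,s}$ as $\varepsilon\downarrow 0$. (iii) For all $t>s$, $\mu_{t-\varepsilon,s}\circ U(t,t-\varepsilon)^{-1}\Rightarrow\mu_{t,s}$ as $\varepsilon\downarrow0$.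
   Context: An evolution family on $\mathbb{H}$ is a family $(U(t,s))_{t\ge s}$, $s,t\in\mathbb{R}$, of bounded linear operators with $U(s,s)=I$, $U(t,r)U(r,s)=U(t,s)$ for $t\ge r\ge s$, and $(t,s)\mapsto U(t,s)x$ continuous on $\{t\ge s\}$ for each $x\in\mathbb{H}$. $\Rightarrow$ denotes weak convergence of probability measures (tested against bounded continuous functions); $\mu\circ T^{-1}$ is the image measure; $*$ is convolution. *)

theory Defs
  imports "HOL-Probability.Probability"
begin

definition evolution_family :: "(real \<Rightarrow> real \<Rightarrow> 'a::real_normed_vector \<Rightarrow> 'a) \<Rightarrow> bool" where
  "evolution_family U \<longleftrightarrow>
     (\<forall>t s. s \<le> t \<longrightarrow> bounded_linear (U t s)) \<and>
     (\<forall>s. U s s = id) \<and>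
     (\<forall>t r s. s \<le> r \<longrightarrow> r \<le> t \<longrightarrow> U t r \<circ> U r s = U t s) \<and>
     (\<forall>x. continuous_on {(t, s). s \<le> t} (\<lambda>(t, s). U t s x))"

(* The library's convolution is restricted to ordered_euclidean_space, hence to finite
   dimension; this is the same definition on a general normed space.  Second countability
   makes addition measurable for the product sigma-algebra, so that distr is the genuine
   image measure. *)
definition convol ::
  "'a::{real_normed_vector, second_countable_topology} measure \<Rightarrow> 'a measure \<Rightarrow> 'a measure" where
  "convol M N = distr (M \<Otimes>\<^sub>M N) borel (\<lambda>(x, y). x + y)"

(* The library's weak_conv_m is restricted to sequences of measures on the real line. *)
definition weakly_converges ::
  "('i \<Rightarrow> 'a::topological_space measure) \<Rightarrow> 'a measure \<Rightarrow> 'i filter \<Rightarrow> bool" where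
  "weakly_converges M N F \<longleftrightarrow>
     (\<forall>f :: 'a \<Rightarrow> real. continuous_on UNIV f \<longrightarrow> bounded (range f) \<longrightarrow>
        ((\<lambda>i. \<integral>x. f x \<partial>(M i)) \<longlongrightarrow> (\<integral>x. f x \<partial>N)) F)"

definition weakly_continuous_on ::
  "'i::topological_space set \<Rightarrow> ('i \<Rightarrow> 'a::topological_space measure) \<Rightarrow> bool" where
  "weakly_continuous_on S M \<longleftrightarrow> (\<forall>s\<in>S. weakly_converges M (M s) (at s within S))"

end

theory Submission
  imports Defs
begin

text \<open>
  Each of the three limits compares \<open>\<mu> t s\<close> with a measure that differs from it by a convolution
  factor converging to the point mass at \<open>0\<close>. In terms of random variables, a convolution is the
  law of a sum, so a vanishing factor is a summand that tends to \<open>0\<close> in probability, and Slutsky's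
  argument (\<open>slutsky\<close>) says that adding or removing it does not change the weak limit. It is used
  in two forms: \<open>convol_perturbation\<close> adds a vanishing summand to a fixed law, which may moreover be
  moved by maps close to the identity, and \<open>convol_cancel\<close> removes a vanishing summand from sums
  with a fixed law.

  For (i), let \<open>r\<close> tend to \<open>s\<close>. If \<open>r < s\<close>, then \<open>\<mu> t r\<close> is the convolution of the fixed
  measure \<open>\<mu> t s\<close> with the image of \<open>\<mu> s r\<close> under the fixed operator \<open>U t s\<close>, a perturbation.
  If \<open>s < r\<close>, then the fixed measure \<open>\<mu> t s\<close> is the convolution of \<open>\<mu> t r\<close> with the image of
  \<open>\<mu> r s\<close> under \<open>U t r\<close>, a cancellation. Here the operator varies as well, and the image vanishes
  only because the operators \<open>U t r\<close>, \<open>s \<le> r \<le> t\<close>, are uniformly bounded: their orbits are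
  bounded by continuity on a compact interval, and \<open>uniform_boundedness_principle\<close> applies.
  Statement (ii) is a perturbation in which \<open>\<mu> t s\<close> is moved by \<open>U (t + \<epsilon>) t\<close>, which tends to the
  identity pointwise and therefore in \<open>\<mu> t s\<close>-measure. Statement (iii) is a cancellation of
  \<open>\<mu> t (t - \<epsilon>)\<close>.

  Slutsky's argument is usually given on \<open>\<real>\<^sup>n\<close> or with tightness, to have uniform continuity of the
  test function on a compact set of large measure. Any exhaustion of the space by sets on which the
  test function has a fixed modulus of continuity does as well. Such sets are closed, hence
  measurable, and continuity from above of the measure makes their complements small
  (\<open>small_complement_of_exhaustion\<close>); the same lemma turns pointwise convergence of operators
  into convergence in measure.
\<close>

section \<open>Uniform boundedness\<close>

text \<open>
  The theorem of Banach and Steinhaus, by Baire's category theorem: the closed sets on which the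
  whole family is bounded by \<open>n\<close> cover the space, so one of them contains a ball, and linearity
  carries the bound from that ball to all vectors.
\<close>

lemma uniform_boundedness_principle:
  fixes T :: "'i \<Rightarrow> 'a::{real_normed_vector, complete_space} \<Rightarrow> 'b::real_normed_vector"
  assumes lin: "\<And>i. i \<in> I \<Longrightarrow> bounded_linear (T i)"
    and pointwise: "\<And>x. bounded ((\<lambda>i. T i x) ` I)"
  obtains K where "K > 0" "\<And>i x. i \<in> I \<Longrightarrow> norm (T i x) \<le> K * norm x"
proof -
  define C where "C n = {x. \<forall>i\<in>I. norm (T i x) \<le> real n}" for n :: nat
  have closed_C: "closed (C n)" for n
  proof -
    have "C n = (\<Inter>i\<in>I. {x. norm (T i x) \<le> real n})"
      by (auto simp: C_def)
    moreover have "closed {x. norm (T i x) \<le> real n}" if "i \<in> I" for i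
      using linear_continuous_on[OF lin[OF that], of UNIV]
      by (intro closed_Collect_le continuous_on_norm continuous_on_const)
    ultimately show ?thesis by auto
  qed
  have cover: "(\<Union>n. C n) = UNIV"
  proof -
    have "\<exists>n. x \<in> C n" for x
    proof -
      obtain b where b: "\<And>i. i \<in> I \<Longrightarrow> norm (T i x) \<le> b"
        using pointwise[of x] by (auto simp: bounded_iff)
      obtain n :: nat where "b \<le> real n" using real_arch_simple by blast
      with b have "x \<in> C n" by (fastforce simp: C_def)
      then show ?thesis ..
    qed
    then show ?thesis by auto
  qed
  have "\<exists>n. interior (C n) \<noteq> {}"
  proof (rule ccontr)
    assume "\<not> ?thesis"
    then have "(euclidean :: 'a topology) interior_of \<Union>(range C) = {}"
      using closed_C
      by (intro Baire_category_alt) (auto simp: completely_metrizable_space_euclidean)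
    with cover show False by simp
  qed
  then obtain n x0 r where r: "r > 0" and ball: "cball x0 r \<subseteq> C n"
    by (meson equals0I mem_interior_cball)
  \<comment> \<open>The summand 1 keeps the bound positive when \<open>n = 0\<close>.\<close>
  define K where "K = (2 * real n + 1) / r"
  have "norm (T i x) \<le> K * norm x" if i: "i \<in> I" for i x
  proof (cases "x = 0")
    case True
    then show ?thesis using lin[OF i] by (simp add: bounded_linear.linear linear_0)
  next
    case False
    interpret bounded_linear "T i" by (rule lin[OF i])
    \<comment> \<open>The multiple of \<open>x\<close> of length \<open>r\<close> is the difference of two points of the ball.\<close>
    define y where "y = (r / norm x) *\<^sub>R x"
    have "x0 + y \<in> C n" "x0 \<in> C n"
      using ball r False by (auto simp: y_def dist_norm intro!: subsetD[OF ball])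
    then have "norm (T i (x0 + y)) \<le> n" "norm (T i x0) \<le> n"
      using i by (auto simp: C_def)
    then have "norm (T i y) \<le> 2 * real n"
      using norm_triangle_ineq4[of "T i (x0 + y)" "T i x0"] by (simp add: add)
    moreover have "norm (T i y) = r / norm x * norm (T i x)"
      using r by (simp add: y_def scaleR)
    ultimately have "r * norm (T i x) \<le> 2 * real n * norm x"
      using False by (simp add: field_simps)
    also have "\<dots> \<le> (2 * real n + 1) * norm x"
      by (simp add: mult_right_mono)
    finally show ?thesis using r by (simp add: K_def field_simps)
  qed
  moreover have "K > 0" using r by (simp add: K_def add_nonneg_pos)
  ultimately show ?thesis using that by blast
qed

section \<open>Convergence in probability\<close>

text \<open>
  Continuity from above of the measure along the sequence \<open>\<delta> = 1 / (n + 1)\<close>. It stands in for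
  tightness: it yields a set of almost full measure on which a quantity that is controlled at each
  point separately is controlled uniformly.
\<close>

lemma small_complement_of_exhaustion:
  fixes A :: "real \<Rightarrow> 'a::topological_space set"
  assumes \<nu>: "prob_space \<nu>" "sets \<nu> = sets borel"
    and closed: "\<And>\<delta>. closed (A \<delta>)"
    and nested: "\<And>\<delta> \<delta>'. \<delta> \<le> \<delta>' \<Longrightarrow> A \<delta>' \<subseteq> A \<delta>"
    and exhausts: "\<And>x. \<exists>\<delta>>0. x \<in> A \<delta>"
    and "\<eta> > 0"
  shows "\<exists>\<delta>>0. measure \<nu> (- A \<delta>) < \<eta>"
proof -
  interpret prob_space \<nu> by fact
  define D where "D n = - A (1 / real (Suc n))" for n
  have "(\<lambda>n. measure \<nu> (D n)) \<longlonglongrightarrow> measure \<nu> (\<Inter>n. D n)"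
  proof (rule finite_Lim_measure_decseq)
    show "range D \<subseteq> sets \<nu>"
      using closed by (auto simp: D_def \<nu>(2))
    show "decseq D"
      unfolding D_def decseq_def by (intro allI impI Compl_anti_mono nested) (simp add: frac_le)
  qed
  moreover have "(\<Inter>n. D n) = {}"
  proof -
    have "\<exists>n. x \<in> A (1 / real (Suc n))" for x
    proof -
      obtain \<delta> where "\<delta> > 0" "x \<in> A \<delta>" using exhausts by blast
      moreover obtain n where "1 / real (Suc n) < \<delta>"
        using nat_approx_posE[OF \<open>\<delta> > 0\<close>] by blast
      ultimately show ?thesis using nested[of "1 / real (Suc n)" \<delta>] by auto
    qed
    then show ?thesis by (auto simp: D_def)
  qed
  ultimately have "(\<lambda>n. measure \<nu> (D n)) \<longlonglongrightarrow> 0" by simp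
  then have "\<forall>\<^sub>F n in sequentially. measure \<nu> (D n) < \<eta>"
    using \<open>\<eta> > 0\<close> by (rule order_tendstoD)
  then obtain n where "measure \<nu> (D n) < \<eta>"
    by (auto dest: eventually_happens)
  then show ?thesis
    by (intro exI[of _ "1 / real (Suc n)"]) (simp add: D_def)
qed

lemma weakly_converges_cong:
  assumes "\<forall>\<^sub>F i in F. M i = M' i"
  shows "weakly_converges M N F \<longleftrightarrow> weakly_converges M' N F"
proof -
  have "((\<lambda>i. \<integral>x. f x \<partial>M i) \<longlongrightarrow> l) F \<longleftrightarrow> ((\<lambda>i. \<integral>x. f x \<partial>M' i) \<longlongrightarrow> l) F"
    for f :: "'b \<Rightarrow> real" and l
    by (rule tendsto_cong) (use assms in eventually_elim, simp)
  then show ?thesis by (simp add: weakly_converges_def)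
qed

text \<open>
  Fix a test function \<open>f\<close> and a tolerance \<open>\<eta>\<close>. Outside two events, \<open>f (W i)\<close> and \<open>f (Z i)\<close>
  differ by at most \<open>\<eta>\<close>: the event that \<open>Z i\<close> lies where \<open>f\<close> oscillates by more than \<open>\<eta>\<close> within
  distance \<open>\<delta>\<close>, and the event that \<open>W i\<close> is at distance at least \<open>\<delta>\<close> from \<open>Z i\<close>. The first has
  the same small probability for all \<open>i\<close> because \<open>Z i\<close> always has law \<open>\<nu>\<close>; the second vanishes in
  the limit. The probability space may depend on \<open>i\<close>, which allows products of varying measures.
\<close>

lemma slutsky:
  fixes Z W :: "'i \<Rightarrow> 'b \<Rightarrow> 'a::{real_normed_vector, second_countable_topology}"
  assumes \<nu>: "prob_space \<nu>" "sets \<nu> = sets borel"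
    and rv: "\<forall>\<^sub>F i in F. prob_space (P i) \<and> Z i \<in> borel_measurable (P i) \<and>
               W i \<in> borel_measurable (P i) \<and> distr (P i) borel (Z i) = \<nu>"
    and close: "\<And>\<delta>. \<delta> > 0 \<Longrightarrow>
      ((\<lambda>i. measure (P i) {\<omega> \<in> space (P i). \<delta> \<le> norm (W i \<omega> - Z i \<omega>)}) \<longlongrightarrow> 0) F"
  shows "weakly_converges (\<lambda>i. distr (P i) borel (W i)) \<nu> F"
  unfolding weakly_converges_def
proof (intro allI impI)
  fix f :: "'a \<Rightarrow> real"
  assume cont: "continuous_on UNIV f" and "bounded (range f)"
  then obtain B where B: "\<And>x. \<bar>f x\<bar> \<le> B" and "B \<ge> 0"
    by (auto simp: bounded_iff) (metis abs_ge_zero order_trans)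
  have [measurable]: "f \<in> borel_measurable borel"
    by (rule borel_measurable_continuous_onI[OF cont])
  show "((\<lambda>i. \<integral>x. f x \<partial>distr (P i) borel (W i)) \<longlongrightarrow> (\<integral>x. f x \<partial>\<nu>)) F"
  proof (rule tendstoI)
    fix e :: real assume "e > 0"
    \<comment> \<open>The error below is at most \<open>(1 + 4 * B) * \<eta>\<close>: one \<open>\<eta>\<close>, and \<open>2 * B * \<eta>\<close> for each exceptional event.\<close>
    define \<eta> where "\<eta> = e / (2 + 4 * B)"
    have "\<eta> > 0" using \<open>e > 0\<close> \<open>B \<ge> 0\<close> by (simp add: \<eta>_def)
    define A where "A \<delta> = {z. \<forall>y. norm y < \<delta> \<longrightarrow> \<bar>f (z + y) - f z\<bar> \<le> \<eta>}" for \<delta>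
    have closed_A: "closed (A \<delta>)" for \<delta>
    proof -
      have "A \<delta> = (\<Inter>y\<in>ball 0 \<delta>. {z. \<bar>f (z + y) - f z\<bar> \<le> \<eta>})"
        by (auto simp: A_def)
      moreover have "closed {z. \<bar>f (z + y) - f z\<bar> \<le> \<eta>}" for y
        by (intro closed_Collect_le continuous_intros continuous_on_compose2[OF cont]) auto
      ultimately show ?thesis by auto
    qed
    have "\<exists>\<delta>>0. measure \<nu> (- A \<delta>) < \<eta>"
    proof (rule small_complement_of_exhaustion[OF \<nu> closed_A _ _ \<open>\<eta> > 0\<close>])
      show "A \<delta>' \<subseteq> A \<delta>" if "\<delta> \<le> \<delta>'" for \<delta> \<delta>'
        using that by (fastforce simp: A_def)
      show "\<exists>\<delta>>0. x \<in> A \<delta>" for x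
      proof -
        have "isCont f x" using cont by (simp add: continuous_on_eq_continuous_at)
        then obtain d where "d > 0" "\<And>x'. dist x' x < d \<Longrightarrow> dist (f x') (f x) < \<eta>"
          using \<open>\<eta> > 0\<close> unfolding continuous_at_eps_delta by blast
        then show ?thesis
          by (intro exI[of _ d])
             (auto simp: A_def dist_norm intro!: less_imp_le)
      qed
    qed
    then obtain \<delta> where "\<delta> > 0" and \<delta>: "measure \<nu> (- A \<delta>) < \<eta>" by blast
    have [measurable]: "A \<delta> \<in> sets borel" using closed_A by auto
    show "\<forall>\<^sub>F i in F. dist (\<integral>x. f x \<partial>distr (P i) borel (W i)) (\<integral>x. f x \<partial>\<nu>) < e"
      using rv order_tendstoD(2)[OF close[OF \<open>\<delta> > 0\<close>] \<open>\<eta> > 0\<close>]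
    proof eventually_elim
      case (elim i)
      define far where "far = {\<omega> \<in> space (P i). \<delta> \<le> norm (W i \<omega> - Z i \<omega>)}"
      define bad where "bad = {\<omega> \<in> space (P i). Z i \<omega> \<in> - A \<delta>}"
      interpret prob_space "P i" using elim by simp
      have [measurable]: "Z i \<in> borel_measurable (P i)" "W i \<in> borel_measurable (P i)"
        using elim by auto
      have [measurable]: "far \<in> sets (P i)" "bad \<in> sets (P i)"
        unfolding far_def bad_def by measurable
      have fZ: "integrable (P i) (\<lambda>\<omega>. f (Z i \<omega>))" and fW: "integrable (P i) (\<lambda>\<omega>. f (W i \<omega>))"
        using B by (auto intro!: integrable_const_bound[where B = B])
      have indicators: "integrable (P i) (indicat_real bad)" "integrable (P i) (indicat_real far)"
        by (simp_all add: integrable_indicator_iff less_top[symmetric])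
      have far: "measure (P i) far < \<eta>" using elim by (simp add: far_def)
      have bad: "measure (P i) bad < \<eta>"
      proof -
        have "measure (P i) bad = measure (distr (P i) borel (Z i)) (- A \<delta>)"
          by (subst measure_distr) (auto simp: bad_def vimage_def Int_def conj_commute)
        then show ?thesis using elim \<delta> by simp
      qed
      have "\<bar>f (W i \<omega>) - f (Z i \<omega>)\<bar> \<le> \<eta> + 2 * B * indicator bad \<omega> + 2 * B * indicator far \<omega>"
        if "\<omega> \<in> space (P i)" for \<omega>
      proof (cases "\<omega> \<in> bad \<or> \<omega> \<in> far")
        case True
        have "\<bar>f (W i \<omega>) - f (Z i \<omega>)\<bar> \<le> 2 * B"
          using B[of "W i \<omega>"] B[of "Z i \<omega>"] by simp
        then show ?thesis using True \<open>B \<ge> 0\<close> \<open>\<eta> > 0\<close> by (auto simp: indicator_def)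
      next
        case False
        then have "Z i \<omega> \<in> A \<delta>" "norm (W i \<omega> - Z i \<omega>) < \<delta>"
          using that by (auto simp: bad_def far_def)
        then have "\<bar>f (Z i \<omega> + (W i \<omega> - Z i \<omega>)) - f (Z i \<omega>)\<bar> \<le> \<eta>"
          unfolding A_def by blast
        then show ?thesis using False by simp
      qed
      then have "\<bar>\<integral>\<omega>. f (W i \<omega>) - f (Z i \<omega>) \<partial>P i\<bar>
          \<le> (\<integral>\<omega>. \<eta> + 2 * B * indicator bad \<omega> + 2 * B * indicator far \<omega> \<partial>P i)"
        using fZ fW
        by (intro order_trans[OF integral_abs_bound] integral_mono)
          (auto simp: indicators)
      also have "\<dots> = \<eta> + 2 * B * measure (P i) bad + 2 * B * measure (P i) far"
        by (simp add: indicators prob_space)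
      finally have "\<bar>\<integral>\<omega>. f (W i \<omega>) - f (Z i \<omega>) \<partial>P i\<bar>
          \<le> \<eta> + 2 * B * measure (P i) bad + 2 * B * measure (P i) far" .
      moreover have "2 * B * measure (P i) bad \<le> 2 * B * \<eta>"
        using \<open>B \<ge> 0\<close> bad by (intro mult_left_mono) auto
      moreover have "2 * B * measure (P i) far \<le> 2 * B * \<eta>"
        using \<open>B \<ge> 0\<close> far by (intro mult_left_mono) auto
      moreover have "\<eta> + 2 * B * \<eta> + 2 * B * \<eta> < e"
      proof -
        have "(2 + 4 * B) * \<eta> = e" using \<open>B \<ge> 0\<close> by (simp add: \<eta>_def)
        then show ?thesis using \<open>\<eta> > 0\<close> by (simp add: algebra_simps)
      qed
      ultimately have "\<bar>(\<integral>\<omega>. f (W i \<omega>) \<partial>P i) - (\<integral>\<omega>. f (Z i \<omega>) \<partial>P i)\<bar> < e"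
        using fZ fW by simp
      moreover have "(\<integral>x. f x \<partial>distr (P i) borel (W i)) = (\<integral>\<omega>. f (W i \<omega>) \<partial>P i)"
        by (rule integral_distr) measurable
      moreover have "(\<integral>x. f x \<partial>\<nu>) = (\<integral>\<omega>. f (Z i \<omega>) \<partial>P i)"
        using elim integral_distr[of "Z i" "P i" borel f] by simp
      ultimately show ?case by (simp add: dist_real_def)
    qed
  qed
qed

text \<open>
  For families of Borel probability measures this is weak convergence to the point mass at \<open>0\<close>, in
  the form of convergence in probability. Membership in the class of Borel probability measures is
  demanded only eventually, since the measures at hand are meaningful only on one side of a point.
\<close>

definition concentrates_at_0 :: "('i \<Rightarrow> 'a::real_normed_vector measure) \<Rightarrow> 'i filter \<Rightarrow> bool" where
  "concentrates_at_0 \<rho> F \<longleftrightarrow>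
     (\<forall>\<^sub>F i in F. prob_space (\<rho> i) \<and> sets (\<rho> i) = sets borel) \<and>
     (\<forall>\<delta>>0. ((\<lambda>i. measure (\<rho> i) {x. \<delta> \<le> norm x}) \<longlongrightarrow> 0) F)"

lemma concentrates_at_0_mono:
  "concentrates_at_0 \<rho> G" if "concentrates_at_0 \<rho> F" "G \<le> F"
  using that by (auto simp: concentrates_at_0_def intro: filter_leD tendsto_mono)

text \<open>
  Markov's inequality for the bounded continuous function \<open>min 1 (norm x / \<delta>)\<close>, which vanishes
  at \<open>0\<close> and dominates the indicator of the tail.
\<close>

lemma concentrates_at_0_if_weakly_converges:
  fixes \<rho> :: "'i \<Rightarrow> 'a::real_normed_vector measure"
  assumes conv: "weakly_converges \<rho> (return borel 0) F"
    and \<rho>: "\<forall>\<^sub>F i in F. prob_space (\<rho> i) \<and> sets (\<rho> i) = sets borel"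
  shows "concentrates_at_0 \<rho> F"
  unfolding concentrates_at_0_def
proof (intro conjI allI impI)
  fix \<delta> :: real assume "\<delta> > 0"
  define f where "f x = min 1 (norm x / \<delta>)" for x :: 'a
  have f01: "0 \<le> f x" "f x \<le> 1" for x using \<open>\<delta> > 0\<close> by (auto simp: f_def)
  have cont: "continuous_on UNIV f"
    unfolding f_def using \<open>\<delta> > 0\<close> by (intro continuous_intros) auto
  have meas [measurable]: "f \<in> borel_measurable borel"
    by (rule borel_measurable_continuous_onI[OF cont])
  have "bounded (range f)"
    using f01 by (auto simp: bounded_iff abs_le_iff intro!: exI[of _ 1] order_trans[OF _ f01(1)])
  then have "((\<lambda>i. \<integral>x. f x \<partial>\<rho> i) \<longlongrightarrow> (\<integral>x. f x \<partial>return borel 0)) F"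
    using conv cont by (auto simp: weakly_converges_def)
  moreover have "(\<integral>x. f x \<partial>return borel 0) = 0"
    using integral_return[of 0 borel f] meas by (simp add: f_def)
  ultimately have lim: "((\<lambda>i. \<integral>x. f x \<partial>\<rho> i) \<longlongrightarrow> 0) F" by simp
  show "((\<lambda>i. measure (\<rho> i) {x. \<delta> \<le> norm x}) \<longlongrightarrow> 0) F"
  proof (rule tendsto_sandwich[OF _ _ tendsto_const lim])
    show "\<forall>\<^sub>F i in F. measure (\<rho> i) {x. \<delta> \<le> norm x} \<le> (\<integral>x. f x \<partial>\<rho> i)"
      using \<rho>
    proof eventually_elim
      case (elim i)
      interpret prob_space "\<rho> i" using elim by simp
      have sets [measurable_cong]: "sets (\<rho> i) = sets borel" using elim by simp
      have ev: "{x. \<delta> \<le> norm x} \<in> sets (\<rho> i)"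
        unfolding sets by (intro borel_closed closed_Collect_le continuous_intros)
      have "measure (\<rho> i) {x. \<delta> \<le> norm x} = (\<integral>x. indicator {x. \<delta> \<le> norm x} x \<partial>\<rho> i)"
        using ev by simp
      also have "\<dots> \<le> (\<integral>x. f x \<partial>\<rho> i)"
      proof (rule integral_mono)
        show "integrable (\<rho> i) (\<lambda>x. indicator {x. \<delta> \<le> norm x} x :: real)"
          using ev by (simp add: integrable_indicator_iff less_top[symmetric])
        show "integrable (\<rho> i) f"
          using f01 by (intro integrable_const_bound[where B = 1]) auto
        show "indicator {x. \<delta> \<le> norm x} x \<le> f x" for x
          using f01 \<open>\<delta> > 0\<close> by (auto simp: indicator_def f_def)
      qed
      finally show ?case .
    qed
  qed simp
qed (fact \<rho>)

text \<open>
  A bound that is uniform in \<open>i\<close> puts the preimage of the tail at level \<open>\<delta>\<close> inside the tail at the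
  single level \<open>\<delta> / K\<close>.
\<close>

lemma concentrates_at_0_image:
  fixes T :: "'i \<Rightarrow> 'a::real_normed_vector \<Rightarrow> 'b::real_normed_vector"
  assumes \<rho>: "concentrates_at_0 \<rho> F"
    and meas: "\<forall>\<^sub>F i in F. T i \<in> borel_measurable borel"
    and equicont: "\<forall>\<^sub>F i in F. \<forall>x. norm (T i x) \<le> K * norm x" and "K > 0"
  shows "concentrates_at_0 (\<lambda>i. distr (\<rho> i) borel (T i)) F"
  unfolding concentrates_at_0_def
proof (intro conjI allI impI)
  have prob: "\<forall>\<^sub>F i in F. prob_space (\<rho> i) \<and> sets (\<rho> i) = sets borel"
    using \<rho> by (simp add: concentrates_at_0_def)
  show "\<forall>\<^sub>F i in F. prob_space (distr (\<rho> i) borel (T i)) \<and> sets (distr (\<rho> i) borel (T i)) = sets borel"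
    using prob meas
    by eventually_elim (auto intro!: prob_space.prob_space_distr cong: measurable_cong_sets)
  fix \<delta> :: real assume "\<delta> > 0"
  then have lim: "((\<lambda>i. measure (\<rho> i) {x. \<delta> / K \<le> norm x}) \<longlongrightarrow> 0) F"
    using \<rho> \<open>K > 0\<close> by (simp add: concentrates_at_0_def)
  show "((\<lambda>i. measure (distr (\<rho> i) borel (T i)) {x. \<delta> \<le> norm x}) \<longlongrightarrow> 0) F"
  proof (rule tendsto_sandwich[OF _ _ tendsto_const lim])
    show "\<forall>\<^sub>F i in F. measure (distr (\<rho> i) borel (T i)) {x. \<delta> \<le> norm x}
        \<le> measure (\<rho> i) {x. \<delta> / K \<le> norm x}"
      using prob meas equicont
    proof eventually_elim
      case (elim i)
      interpret prob_space "\<rho> i" using elim by simp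
      have sets: "sets (\<rho> i) = sets borel" using elim by simp
      have space: "space (\<rho> i) = UNIV" using sets_eq_imp_space_eq[OF sets] by simp
      have T: "T i \<in> borel_measurable (\<rho> i)"
        using elim(2) sets by (simp cong: measurable_cong_sets)
      have "measure (distr (\<rho> i) borel (T i)) {x. \<delta> \<le> norm x}
          = measure (\<rho> i) (T i -` {x. \<delta> \<le> norm x} \<inter> space (\<rho> i))"
        using T by (intro measure_distr borel_closed closed_Collect_le continuous_intros)
      also have "\<dots> \<le> measure (\<rho> i) {x. \<delta> / K \<le> norm x}"
      proof (rule finite_measure_mono)
        show "{x. \<delta> / K \<le> norm x} \<in> sets (\<rho> i)"
          unfolding sets by (intro borel_closed closed_Collect_le continuous_intros)
        show "T i -` {x. \<delta> \<le> norm x} \<inter> space (\<rho> i) \<subseteq> {x. \<delta> / K \<le> norm x}"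
          using elim(3) \<open>K > 0\<close> by (auto simp: field_simps intro: order_trans)
      qed
      finally show ?case .
    qed
  qed simp
qed

section \<open>Weak limits of convolutions\<close>

lemma measure_pair_fst:
  assumes "prob_space N" "A \<in> sets M"
  shows "measure (M \<Otimes>\<^sub>M N) {\<omega> \<in> space (M \<Otimes>\<^sub>M N). fst \<omega> \<in> A} = measure M A"
proof -
  have "measure (distr (M \<Otimes>\<^sub>M N) M fst) A = measure (M \<Otimes>\<^sub>M N) {\<omega> \<in> space (M \<Otimes>\<^sub>M N). fst \<omega> \<in> A}"
    using assms(2) by (subst measure_distr) (auto simp: vimage_def Int_def conj_commute)
  then show ?thesis using prob_space.distr_pair_fst[OF assms(1), of M] by simp
qed

lemma distr_pair_snd:
  assumes "prob_space M" "prob_space N"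
  shows "distr (M \<Otimes>\<^sub>M N) N snd = N"
proof -
  interpret M: prob_space M by fact
  interpret N: prob_space N by fact
  interpret pair_prob_space N M ..
  have "distr (M \<Otimes>\<^sub>M N) N snd = distr (distr (M \<Otimes>\<^sub>M N) (N \<Otimes>\<^sub>M M) (\<lambda>(x, y). (y, x))) N fst"
    by (subst distr_distr) (auto simp: comp_def case_prod_beta intro!: distr_cong)
  also have "\<dots> = N"
    by (simp add: distr_pair_swap[symmetric] M.distr_pair_fst)
  finally show ?thesis .
qed

lemma measure_pair_snd:
  assumes "prob_space M" "prob_space N" "A \<in> sets N"
  shows "measure (M \<Otimes>\<^sub>M N) {\<omega> \<in> space (M \<Otimes>\<^sub>M N). snd \<omega> \<in> A} = measure N A"
proof -
  have "measure (distr (M \<Otimes>\<^sub>M N) N snd) A = measure (M \<Otimes>\<^sub>M N) {\<omega> \<in> space (M \<Otimes>\<^sub>M N). snd \<omega> \<in> A}"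
    using assms(3) by (subst measure_distr) (auto simp: vimage_def Int_def conj_commute)
  then show ?thesis using distr_pair_snd[OF assms(1,2)] by simp
qed

lemma convol_commute:
  fixes M N :: "'a::{real_normed_vector, second_countable_topology} measure"
  assumes "prob_space M" "prob_space N" and [measurable_cong]: "sets M = sets borel" "sets N = sets borel"
  shows "convol M N = convol N M"
proof -
  interpret M: prob_space M by fact
  interpret N: prob_space N by fact
  interpret pair_prob_space M N ..
  have "convol M N = distr (distr (N \<Otimes>\<^sub>M M) (M \<Otimes>\<^sub>M N) (\<lambda>(x, y). (y, x))) borel (\<lambda>(x, y). x + y)"
    unfolding convol_def by (subst distr_pair_swap) simp
  also have "\<dots> = convol N M"
    unfolding convol_def
    by (subst distr_distr) (auto simp: comp_def case_prod_beta add.commute intro!: distr_cong)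
  finally show ?thesis .
qed

text \<open>
  Let \<open>X\<close> and \<open>Y\<close> be independent with laws \<open>\<rho> i\<close> and \<open>\<nu>\<close>. The convolution is the law of
  \<open>X + T i Y\<close>, which differs from \<open>Y\<close> by \<open>X + (T i Y - Y)\<close>, a sum of two terms that vanish in
  probability.
\<close>

lemma convol_perturbation:
  fixes \<nu> :: "'a::{real_normed_vector, second_countable_topology} measure"
  assumes \<nu>: "prob_space \<nu>" "sets \<nu> = sets borel"
    and \<rho>: "concentrates_at_0 \<rho> F"
    and meas: "\<forall>\<^sub>F i in F. T i \<in> borel_measurable borel"
    and near_id: "\<And>\<delta>. \<delta> > 0 \<Longrightarrow> ((\<lambda>i. measure \<nu> {y. \<delta> \<le> norm (T i y - y)}) \<longlongrightarrow> 0) F"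
  shows "weakly_converges (\<lambda>i. convol (\<rho> i) (distr \<nu> borel (T i))) \<nu> F"
proof -
  have [measurable_cong]: "sets \<nu> = sets borel" by fact
  define W where "W i \<omega> = fst \<omega> + T i (snd \<omega>)" for i and \<omega> :: "'a \<times> 'a"
  have nice: "\<forall>\<^sub>F i in F. prob_space (\<rho> i) \<and> sets (\<rho> i) = sets borel \<and> T i \<in> borel_measurable borel"
    using \<rho> meas by (auto simp: concentrates_at_0_def eventually_conj_iff)
  have "\<forall>\<^sub>F i in F. distr (\<rho> i \<Otimes>\<^sub>M \<nu>) borel (W i) = convol (\<rho> i) (distr \<nu> borel (T i))"
    using nice
  proof eventually_elim
    case (elim i)
    have [measurable_cong]: "sets (\<rho> i) = sets borel" and [measurable]: "T i \<in> borel_measurable borel"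
      using elim by auto
    have "prob_space (distr \<nu> borel (T i))"
      using \<nu>(1) by (rule prob_space.prob_space_distr) measurable
    then have "\<rho> i \<Otimes>\<^sub>M distr \<nu> borel (T i)
        = distr (\<rho> i \<Otimes>\<^sub>M \<nu>) (borel \<Otimes>\<^sub>M borel) (\<lambda>(x, y). (x, T i y))"
      using pair_measure_distr[of "\<lambda>x. x" "\<rho> i" borel "T i" \<nu> borel]
        distr_id2[of borel "\<rho> i"] elim
      by (simp add: prob_space_imp_sigma_finite)
    then show ?case
      unfolding convol_def
      by (simp add: distr_distr comp_def W_def[abs_def] case_prod_beta)
  qed
  moreover have "weakly_converges (\<lambda>i. distr (\<rho> i \<Otimes>\<^sub>M \<nu>) borel (W i)) \<nu> F"
  proof (rule slutsky[where Z = "\<lambda>i. snd"])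
    show "\<forall>\<^sub>F i in F. prob_space (\<rho> i \<Otimes>\<^sub>M \<nu>) \<and> snd \<in> borel_measurable (\<rho> i \<Otimes>\<^sub>M \<nu>) \<and>
        W i \<in> borel_measurable (\<rho> i \<Otimes>\<^sub>M \<nu>) \<and> distr (\<rho> i \<Otimes>\<^sub>M \<nu>) borel snd = \<nu>"
      using nice
    proof eventually_elim
      case (elim i)
      have [measurable_cong]: "sets (\<rho> i) = sets borel" and [measurable]: "T i \<in> borel_measurable borel"
        using elim by auto
      have "distr (\<rho> i \<Otimes>\<^sub>M \<nu>) borel snd = distr (\<rho> i \<Otimes>\<^sub>M \<nu>) \<nu> snd"
        by (rule distr_cong) (auto simp: \<nu>(2))
      then show ?case
        using elim \<nu>(1) by (auto simp: distr_pair_snd W_def[abs_def] intro: prob_space_pair)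
    qed
    fix \<delta> :: real assume "\<delta> > 0"
    have "((\<lambda>i. measure (\<rho> i) {x. \<delta> / 2 \<le> norm x}) \<longlongrightarrow> 0) F"
      using \<rho> half_gt_zero[OF \<open>\<delta> > 0\<close>] unfolding concentrates_at_0_def by blast
    then have lim: "((\<lambda>i. measure (\<rho> i) {x. \<delta> / 2 \<le> norm x}
        + measure \<nu> {y. \<delta> / 2 \<le> norm (T i y - y)}) \<longlongrightarrow> 0) F"
      using \<open>\<delta> > 0\<close> by (intro tendsto_add_zero near_id) simp_all
    show "((\<lambda>i. measure (\<rho> i \<Otimes>\<^sub>M \<nu>) {\<omega> \<in> space (\<rho> i \<Otimes>\<^sub>M \<nu>). \<delta> \<le> norm (W i \<omega> - snd \<omega>)}) \<longlongrightarrow> 0) F"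
    proof (rule tendsto_sandwich[OF _ _ tendsto_const lim])
      show "\<forall>\<^sub>F i in F. measure (\<rho> i \<Otimes>\<^sub>M \<nu>) {\<omega> \<in> space (\<rho> i \<Otimes>\<^sub>M \<nu>). \<delta> \<le> norm (W i \<omega> - snd \<omega>)}
          \<le> measure (\<rho> i) {x. \<delta> / 2 \<le> norm x} + measure \<nu> {y. \<delta> / 2 \<le> norm (T i y - y)}"
        using nice
      proof eventually_elim
        case (elim i)
        have [measurable_cong]: "sets (\<rho> i) = sets borel" and [measurable]: "T i \<in> borel_measurable borel"
          using elim by auto
        interpret prob_space "\<rho> i \<Otimes>\<^sub>M \<nu>" using elim \<nu> by (auto intro: prob_space_pair)
        let ?X = "{x. \<delta> / 2 \<le> norm x}" and ?Y = "{y. \<delta> / 2 \<le> norm (T i y - y)}"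
        have X: "?X \<in> sets (\<rho> i)" and Y: "?Y \<in> sets \<nu>"
          using elim \<nu>(2) by auto
        let ?X' = "{\<omega> \<in> space (\<rho> i \<Otimes>\<^sub>M \<nu>). fst \<omega> \<in> ?X}" and ?Y' = "{\<omega> \<in> space (\<rho> i \<Otimes>\<^sub>M \<nu>). snd \<omega> \<in> ?Y}"
        have XY': "?X' \<in> sets (\<rho> i \<Otimes>\<^sub>M \<nu>)" "?Y' \<in> sets (\<rho> i \<Otimes>\<^sub>M \<nu>)"
          by measurable
        have "measure (\<rho> i \<Otimes>\<^sub>M \<nu>) {\<omega> \<in> space (\<rho> i \<Otimes>\<^sub>M \<nu>). \<delta> \<le> norm (W i \<omega> - snd \<omega>)}
            \<le> measure (\<rho> i \<Otimes>\<^sub>M \<nu>) (?X' \<union> ?Y')"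
        proof (rule finite_measure_mono)
          show "{\<omega> \<in> space (\<rho> i \<Otimes>\<^sub>M \<nu>). \<delta> \<le> norm (W i \<omega> - snd \<omega>)} \<subseteq> ?X' \<union> ?Y'"
          proof safe
            fix x y assume "\<delta> \<le> norm (W i (x, y) - snd (x, y))" "\<not> \<delta> / 2 \<le> norm (T i (snd (x, y)) - snd (x, y))"
            then show "\<delta> / 2 \<le> norm (fst (x, y))"
              using norm_triangle_ineq[of x "T i y - y"] by (simp add: W_def algebra_simps)
          qed
        qed (use XY' in auto)
        also have "\<dots> \<le> measure (\<rho> i \<Otimes>\<^sub>M \<nu>) ?X' + measure (\<rho> i \<Otimes>\<^sub>M \<nu>) ?Y'"
          by (rule measure_Un_le) (use XY' in auto)
        also have "\<dots> = measure (\<rho> i) ?X + measure \<nu> ?Y"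
          using measure_pair_fst[OF \<nu>(1) X] measure_pair_snd[OF _ \<nu>(1) Y, of "\<rho> i"] elim by simp
        finally show ?case .
      qed
    qed simp
  qed (use \<nu> in auto)
  ultimately show ?thesis using weakly_converges_cong by fast
qed

text \<open>
  Let \<open>X\<close> and \<open>Y\<close> be independent with laws \<open>M i\<close> and \<open>\<rho> i\<close>. Here the sum \<open>X + Y\<close> is the
  variable with the fixed law \<open>\<nu>\<close>, and \<open>X\<close> differs from it by the vanishing \<open>Y\<close>. So the
  roles in \<open>slutsky\<close> are exchanged: the sum is the reference variable and the summand the perturbed
  one.
\<close>

lemma convol_cancel:
  fixes \<nu> :: "'a::{real_normed_vector, second_countable_topology} measure"
  assumes \<nu>: "prob_space \<nu>" "sets \<nu> = sets borel"
    and M: "\<forall>\<^sub>F i in F. prob_space (M i) \<and> sets (M i) = sets borel"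
    and \<rho>: "concentrates_at_0 \<rho> F"
    and convol: "\<forall>\<^sub>F i in F. convol (M i) (\<rho> i) = \<nu>"
  shows "weakly_converges M \<nu> F"
proof -
  have nice: "\<forall>\<^sub>F i in F. prob_space (\<rho> i) \<and> sets (\<rho> i) = sets borel \<and>
      prob_space (M i) \<and> sets (M i) = sets borel \<and> convol (M i) (\<rho> i) = \<nu>"
    using \<rho> M convol by (auto simp: concentrates_at_0_def eventually_conj_iff)
  have fst: "\<forall>\<^sub>F i in F. distr (M i \<Otimes>\<^sub>M \<rho> i) borel fst = M i"
    using nice
  proof eventually_elim
    case (elim i)
    have "distr (M i \<Otimes>\<^sub>M \<rho> i) borel fst = distr (M i \<Otimes>\<^sub>M \<rho> i) (M i) fst"
      by (rule distr_cong) (auto simp: elim)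
    then show ?case using elim by (simp add: prob_space.distr_pair_fst)
  qed
  have "weakly_converges (\<lambda>i. distr (M i \<Otimes>\<^sub>M \<rho> i) borel fst) \<nu> F"
  proof (rule slutsky[where Z = "\<lambda>i (x, y). x + y"])
    show "\<forall>\<^sub>F i in F. prob_space (M i \<Otimes>\<^sub>M \<rho> i) \<and> (\<lambda>(x, y). x + y) \<in> borel_measurable (M i \<Otimes>\<^sub>M \<rho> i) \<and>
        fst \<in> borel_measurable (M i \<Otimes>\<^sub>M \<rho> i) \<and> distr (M i \<Otimes>\<^sub>M \<rho> i) borel (\<lambda>(x, y). x + y) = \<nu>"
      using nice
    proof eventually_elim
      case (elim i)
      have [measurable_cong]: "sets (M i) = sets borel" "sets (\<rho> i) = sets borel"
        using elim by auto
      show ?case using elim by (auto simp: convol_def intro: prob_space_pair)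
    qed
    fix \<delta> :: real assume "\<delta> > 0"
    then have "((\<lambda>i. measure (\<rho> i) {x. \<delta> \<le> norm x}) \<longlongrightarrow> 0) F"
      using \<rho> by (auto simp: concentrates_at_0_def)
    moreover have "\<forall>\<^sub>F i in F. measure (\<rho> i) {x. \<delta> \<le> norm x} = measure (M i \<Otimes>\<^sub>M \<rho> i)
        {\<omega> \<in> space (M i \<Otimes>\<^sub>M \<rho> i). \<delta> \<le> norm (fst \<omega> - (case \<omega> of (x, y) \<Rightarrow> x + y))}"
      using nice
    proof eventually_elim
      case (elim i)
      have "{x. \<delta> \<le> norm x} \<in> sets (\<rho> i)" using elim by simp
      from measure_pair_snd[OF _ _ this, of "M i"] elim show ?case
        by (simp add: case_prod_beta)
    qed
    ultimately show "((\<lambda>i. measure (M i \<Otimes>\<^sub>M \<rho> i)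
        {\<omega> \<in> space (M i \<Otimes>\<^sub>M \<rho> i). \<delta> \<le> norm (fst \<omega> - (case \<omega> of (x, y) \<Rightarrow> x + y))}) \<longlongrightarrow> 0) F"
      using tendsto_cong by fast
  qed (use \<nu> in auto)
  then show ?thesis using weakly_converges_cong[OF fst] by blast
qed

section \<open>Continuity of the skew convolution family\<close>

text \<open>
  The exhausting sets consist of the points at which all \<open>T \<epsilon>\<close> with \<open>\<epsilon> < \<eta>\<close> are close to the
  identity. They are intersections over uncountably many \<open>\<epsilon>\<close>, and are measurable because continuity
  of each \<open>T \<epsilon>\<close> makes them closed.
\<close>

lemma pointwise_convergence_imp_in_measure:
  fixes T :: "real \<Rightarrow> 'a::real_normed_vector \<Rightarrow> 'a"
  assumes \<nu>: "prob_space \<nu>" "sets \<nu> = sets borel"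
    and cont: "\<And>\<epsilon>. \<epsilon> > 0 \<Longrightarrow> continuous_on UNIV (T \<epsilon>)"
    and lim: "\<And>y. ((\<lambda>\<epsilon>. T \<epsilon> y) \<longlongrightarrow> y) (at_right 0)"
    and "\<delta> > 0"
  shows "((\<lambda>\<epsilon>. measure \<nu> {y. \<delta> \<le> norm (T \<epsilon> y - y)}) \<longlongrightarrow> 0) (at_right 0)"
proof (rule tendstoI)
  fix e :: real assume "e > 0"
  interpret prob_space \<nu> by fact
  define A where "A \<eta> = {y. \<forall>\<epsilon>. 0 < \<epsilon> \<and> \<epsilon> < \<eta> \<longrightarrow> norm (T \<epsilon> y - y) \<le> \<delta> / 2}" for \<eta> :: real
    \<comment> \<open>The bound \<open>\<delta> / 2\<close> lets a non-strict, hence closed, condition exclude the value \<open>\<delta>\<close>.\<close>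
  have closed_A: "closed (A \<eta>)" for \<eta>
  proof -
    have "A \<eta> = (\<Inter>\<epsilon>\<in>{0<..<\<eta>}. {y. norm (T \<epsilon> y - y) \<le> \<delta> / 2})"
      by (auto simp: A_def)
    moreover have "closed {y. norm (T \<epsilon> y - y) \<le> \<delta> / 2}" if "\<epsilon> > 0" for \<epsilon>
      by (intro closed_Collect_le continuous_intros cont that)
    ultimately show ?thesis by auto
  qed
  have "\<exists>\<eta>>0. measure \<nu> (- A \<eta>) < e"
  proof (rule small_complement_of_exhaustion[OF \<nu> closed_A _ _ \<open>e > 0\<close>])
    show "A \<eta>' \<subseteq> A \<eta>" if "\<eta> \<le> \<eta>'" for \<eta> \<eta>'
      using that by (auto simp: A_def)
    show "\<exists>\<eta>>0. y \<in> A \<eta>" for y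
    proof -
      have "\<forall>\<^sub>F \<epsilon> in at_right 0. dist (T \<epsilon> y) y < \<delta> / 2"
        using lim \<open>\<delta> > 0\<close> by (intro tendstoD) auto
      then show ?thesis
        by (fastforce simp: eventually_at_right_field A_def dist_norm)
    qed
  qed
  then obtain \<eta> where "\<eta> > 0" and \<eta>: "measure \<nu> (- A \<eta>) < e" by blast
  have "\<forall>\<^sub>F \<epsilon> in at_right 0. \<epsilon> \<in> {0<..<\<eta>}"
    using \<open>\<eta> > 0\<close> by (intro eventually_at_rightI[of 0 \<eta>])
  then show "\<forall>\<^sub>F \<epsilon> in at_right 0. dist (measure \<nu> {y. \<delta> \<le> norm (T \<epsilon> y - y)}) 0 < e"
  proof eventually_elim
    case (elim \<epsilon>)
    have "measure \<nu> {y. \<delta> \<le> norm (T \<epsilon> y - y)} \<le> measure \<nu> (- A \<eta>)"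
    proof (rule finite_measure_mono)
      show "- A \<eta> \<in> sets \<nu>" using closed_A by (auto simp: \<nu>(2))
      show "{y. \<delta> \<le> norm (T \<epsilon> y - y)} \<subseteq> - A \<eta>"
        using elim \<open>\<delta> > 0\<close> by (fastforce simp: A_def)
    qed
    with \<eta> show ?case by simp
  qed
qed

theorem theorem3p15:
  fixes U :: "real \<Rightarrow> real \<Rightarrow> 'a::{real_inner, complete_space, second_countable_topology} \<Rightarrow> 'a"
    and \<mu> :: "real \<Rightarrow> real \<Rightarrow> 'a measure"
  assumes evol: "evolution_family U"
    and prob: "\<And>t s. s \<le> t \<Longrightarrow> prob_space (\<mu> t s)"
    and borel_sets: "\<And>t s. s \<le> t \<Longrightarrow> sets (\<mu> t s) = sets borel"
    and skew: "\<And>t r s. s \<le> r \<Longrightarrow> r \<le> t \<Longrightarrow>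
                 \<mu> t s = convol (\<mu> t r) (distr (\<mu> r s) borel (U t r))"
    and right: "\<And>s. weakly_converges (\<lambda>t. \<mu> t s) (return borel 0) (at_right s)"
    and left: "\<And>t. weakly_converges (\<lambda>s. \<mu> t s) (return borel 0) (at_left t)"
  shows "(\<forall>t. weakly_continuous_on {..t} (\<lambda>s. \<mu> t s)) \<and>
         (\<forall>t s. s \<le> t \<longrightarrow> weakly_converges (\<lambda>\<epsilon>. \<mu> (t + \<epsilon>) s) (\<mu> t s) (at_right 0)) \<and>
         (\<forall>t s. s < t \<longrightarrow>
            weakly_converges (\<lambda>\<epsilon>. distr (\<mu> (t - \<epsilon>) s) borel (U t (t - \<epsilon>))) (\<mu> t s) (at_right 0))"
proof (intro conjI allI impI)
  have lin: "bounded_linear (U t s)" if "s \<le> t" for t s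
    using evol that by (auto simp: evolution_family_def)
  have cont_U: "continuous_on UNIV (U t s)" if "s \<le> t" for t s
    using lin[OF that] by (simp add: linear_continuous_on)
  have meas_U: "U t s \<in> borel_measurable borel" if "s \<le> t" for t s
    using cont_U[OF that] by (rule borel_measurable_continuous_onI)
  have cont: "continuous_on {(t, s). s \<le> t} (\<lambda>(t, s). U t s x)" for x
    using evol by (auto simp: evolution_family_def)
  have prob_image: "prob_space (distr (\<mu> r s) borel (U t r))" if "s \<le> r" "r \<le> t" for t r s
    using prob[OF that(1)] meas_U[OF that(2)] borel_sets[OF that(1)]
    by (auto intro!: prob_space.prob_space_distr cong: measurable_cong_sets)
  have conc_right: "concentrates_at_0 (\<lambda>t. \<mu> t s) (at_right s)" for s
    by (rule concentrates_at_0_if_weakly_converges[OF right])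
       (auto simp: eventually_at_filter prob borel_sets)
  have conc_left: "concentrates_at_0 (\<lambda>s. \<mu> t s) (at_left t)" for t
    by (rule concentrates_at_0_if_weakly_converges[OF left])
       (auto simp: eventually_at_filter prob borel_sets)
  {
    fix t
    show "weakly_continuous_on {..t} (\<lambda>s. \<mu> t s)"
      unfolding weakly_continuous_on_def
    proof
      fix s assume "s \<in> {..t}"
      then have "s \<le> t" by simp
      note \<nu> = prob[OF \<open>s \<le> t\<close>] borel_sets[OF \<open>s \<le> t\<close>]
      have "weakly_converges (\<lambda>r. \<mu> t r) (\<mu> t s) (at_left s)"
      proof -
        obtain K where K: "\<And>x. norm (U t s x) \<le> norm x * K" "K > 0"
          using bounded_linear.pos_bounded[OF lin[OF \<open>s \<le> t\<close>]] by blast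
        let ?\<rho> = "\<lambda>r. distr (\<mu> s r) borel (U t s)"
        have "concentrates_at_0 ?\<rho> (at_left s)"
          using conc_left[of s] meas_U[OF \<open>s \<le> t\<close>] K
          by (intro concentrates_at_0_image[where K = K]) (auto simp: mult.commute)
        then have "weakly_converges (\<lambda>r. convol (?\<rho> r) (distr (\<mu> t s) borel (\<lambda>x. x))) (\<mu> t s) (at_left s)"
          by (intro convol_perturbation[OF \<nu>]) auto
        moreover have "\<forall>\<^sub>F r in at_left s. convol (?\<rho> r) (distr (\<mu> t s) borel (\<lambda>x. x)) = \<mu> t r"
        proof -
          have "convol (?\<rho> r) (distr (\<mu> t s) borel (\<lambda>x. x)) = \<mu> t r" if "r < s" for r
            using that \<open>s \<le> t\<close> \<nu> skew[of r s t] convol_commute[OF \<nu>(1) prob_image[of r s t] \<nu>(2)]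
            by (simp add: distr_id2)
          then show ?thesis by (auto simp: eventually_at_filter)
        qed
        ultimately show ?thesis using weakly_converges_cong by fast
      qed
      \<comment> \<open>For \<open>s = t\<close> this filter is trivial, so the endpoint needs no separate treatment.\<close>
      moreover have "weakly_converges (\<lambda>r. \<mu> t r) (\<mu> t s) (at s within {s<..t})"
      proof -
        have "bounded ((\<lambda>r. U t r x) ` {s..t})" for x
        proof -
          have "continuous_on {s..t} (\<lambda>r. (\<lambda>(t, s). U t s x) (t, r))"
            by (rule continuous_on_compose2[OF cont]) (auto intro!: continuous_intros)
          then show ?thesis
            by (intro compact_imp_bounded compact_continuous_image) auto
        qed
        then obtain K where K: "K > 0" "\<And>r x. r \<in> {s..t} \<Longrightarrow> norm (U t r x) \<le> K * norm x"
          using uniform_boundedness_principle[of "{s..t}" "U t"] lin by auto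
        let ?\<rho> = "\<lambda>r. distr (\<mu> r s) borel (U t r)"
        have "concentrates_at_0 (\<lambda>r. \<mu> r s) (at s within {s<..t})"
          by (rule concentrates_at_0_mono[OF conc_right]) (auto intro: at_le)
        then have "concentrates_at_0 ?\<rho> (at s within {s<..t})"
          using K
          by (intro concentrates_at_0_image[where K = K]) (auto simp: eventually_at_filter meas_U)
        then show ?thesis
          using \<nu>
          by (intro convol_cancel[where \<rho> = ?\<rho>])
             (auto simp: eventually_at_filter prob borel_sets skew[symmetric])
      qed
      moreover have "at s within {..t} = sup (at_left s) (at s within {s<..t})"
      proof -
        have "{..t} - {s} = {..<s} \<union> {s<..t} - {s}" using \<open>s \<le> t\<close> by auto
        then have "at s within {..t} = at s within ({..<s} \<union> {s<..t})"
          by (simp add: at_within_def)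
        then show ?thesis by (simp add: at_within_union)
      qed
      ultimately show "weakly_converges (\<lambda>s. \<mu> t s) (\<mu> t s) (at s within {..t})"
        by (auto simp: weakly_converges_def filterlim_sup)
    qed
  next
    fix t s :: real assume "s \<le> t"
    note \<nu> = prob[OF \<open>s \<le> t\<close>] borel_sets[OF \<open>s \<le> t\<close>]
    have "((\<lambda>\<epsilon>. U (t + \<epsilon>) t y) \<longlongrightarrow> y) (at_right 0)" for y
    proof -
      have "continuous_on {0..} (\<lambda>\<epsilon>. (\<lambda>(t, s). U t s y) (t + \<epsilon>, t))"
        by (rule continuous_on_compose2[OF cont]) (auto intro!: continuous_intros)
      then have "((\<lambda>\<epsilon>. U (t + \<epsilon>) t y) \<longlongrightarrow> U (t + 0) t y) (at 0 within {0..})"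
        unfolding continuous_on_def by (auto dest: bspec[where x = 0])
      moreover have "U t t y = y" using evol by (simp add: evolution_family_def)
      ultimately show ?thesis by (auto elim: tendsto_within_subset)
    qed
    then have "((\<lambda>\<epsilon>. measure (\<mu> t s) {y. \<delta> \<le> norm (U (t + \<epsilon>) t y - y)}) \<longlongrightarrow> 0) (at_right 0)"
      if "\<delta> > 0" for \<delta>
      using that by (intro pointwise_convergence_imp_in_measure[OF \<nu>] cont_U) auto
    moreover have "concentrates_at_0 (\<lambda>\<epsilon>. \<mu> (t + \<epsilon>) t) (at_right 0)"
      using conc_right[of t]
      by (simp add: concentrates_at_0_def filterlim_at_right_to_0[of _ _ t]
          eventually_at_right_to_0[of _ t] add.commute)
    ultimately have "weakly_converges
        (\<lambda>\<epsilon>. convol (\<mu> (t + \<epsilon>) t) (distr (\<mu> t s) borel (U (t + \<epsilon>) t))) (\<mu> t s) (at_right 0)"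
      by (intro convol_perturbation[OF \<nu>]) (auto simp: eventually_at_filter meas_U)
    moreover have "\<forall>\<^sub>F \<epsilon> in at_right 0.
        convol (\<mu> (t + \<epsilon>) t) (distr (\<mu> t s) borel (U (t + \<epsilon>) t)) = \<mu> (t + \<epsilon>) s"
      using \<open>s \<le> t\<close> by (auto simp: eventually_at_filter skew[symmetric])
    ultimately show "weakly_converges (\<lambda>\<epsilon>. \<mu> (t + \<epsilon>) s) (\<mu> t s) (at_right 0)"
      using weakly_converges_cong by fast
  next
    fix t s :: real assume "s < t"
    then have "s \<le> t" by simp
    note \<nu> = prob[OF \<open>s \<le> t\<close>] borel_sets[OF \<open>s \<le> t\<close>]
    let ?M = "\<lambda>\<epsilon>. distr (\<mu> (t - \<epsilon>) s) borel (U t (t - \<epsilon>))"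
    have small: "\<forall>\<^sub>F \<epsilon> in at_right 0. \<epsilon> \<in> {0<..<t - s}"
      using \<open>s < t\<close> by (intro eventually_at_rightI[of 0 "t - s"]) auto
    have "filterlim (\<lambda>\<epsilon>. t - \<epsilon>) (at_left t) (at_right 0)"
      by (auto simp: filterlim_at eventually_at_filter intro!: tendsto_eq_intros)
    then have conc: "concentrates_at_0 (\<lambda>\<epsilon>. \<mu> t (t - \<epsilon>)) (at_right 0)"
      using conc_left[of t] unfolding concentrates_at_0_def
      by (auto intro: eventually_compose_filterlim filterlim_compose)
    have "\<forall>\<^sub>F \<epsilon> in at_right 0. convol (?M \<epsilon>) (\<mu> t (t - \<epsilon>)) = \<mu> t s"
      using small
    proof eventually_elim
      case (elim \<epsilon>)
      then show ?case
        using skew[of s "t - \<epsilon>" t] convol_commute[of "\<mu> t (t - \<epsilon>)" "?M \<epsilon>"]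
        by (simp add: prob borel_sets prob_image)
    qed
    moreover have "\<forall>\<^sub>F \<epsilon> in at_right 0. prob_space (?M \<epsilon>) \<and> sets (?M \<epsilon>) = sets borel"
      using small by eventually_elim (simp add: prob_image)
    ultimately show "weakly_converges ?M (\<mu> t s) (at_right 0)"
      using conc by (intro convol_cancel[OF \<nu>])
  }
qed

end
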